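(* Let $X$ be a fixed $n\times p$ real matrix, $Y=X\beta^0+\epsilon$, $\sigma>0$, $\bar\lambda>0$, $\underline\lambda>0$, and suppose that $\epsilon\sim\mathcal{N}(0,\sigma^2I)$. Let $\hat\beta(\sigma)$ be the Lasso, and $\hat b_\sharp(\sigma)$ the de-sparsified Lasso with associated $\hat\tau_{j,\sharp}$, $\tilde\tau_{j,\sharp}^2$, as defined in the context. Then for all $j\in\{1,\dots,p\}$ $$\frac{\sqrt n\,(\hat b_{j,\sharp}(\sigma)-\beta_j^0)}{\sigma\,\hat\tau_{j,\sharp}/\tilde\tau_{j,\sharp}^2}=Z_j+\Delta_j,$$ where each $Z_j$ is a random variable with the standard normal distribution $\mathcal{N}(0,1)$, and $\Delta=(\Delta_1,\dots,\Delta_p)^T$ satisfies $$\|\Delta\|_\infty\le\sqrt n\,\underline\lambda\,\|\hat\beta(\sigma)-\beta^0\|_1/\sigma .$$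
   Context: $X$ has rank $n$, $f^0=\mathbb{E}(Y|X)$, $\epsilon=Y-f^0$, and $\beta^0\in\mathbb{R}^p$ is any solution of $f^0=X\beta^0$; $X$ is treated as fixed (non-random). For $v\in\mathbb{R}^n$, $\|v\|_n:=\sqrt{v^Tv/n}$. $\hat\beta(\sigma)$ is a minimizer over $\beta\in\mathbb{R}^p$ of $\|Y-X\beta\|_n^2+\bar\lambda\sigma\|\beta\|_1$. $X_j$ is the $j$-th column of $X$ and $X_{-j}$ the $n\times(p-1)$ matrix of the other columns. For $\tau_j>0$, $\hat\gamma_j(\tau_j)$ is a (chosen) minimizer over $\gamma_j\in\mathbb{R}^{p-1}$ of $\|X_j-X_{-j}\gamma_j\|_n^2+2\underline\lambda\tau_j\|\gamma_j\|_1$. For the square-root node-wise Lasso, for each $j$ the scale $\hat\tau_{j,\sharp}>0$ is a stable point: $\hat\tau_{j,\sharp}^2=\|X_j-X_{-j}\hat\gamma_j(\hat\tau_{j,\sharp})\|_n^2\ne0$ (such scales are assumed to exist). With $\hat\gamma_j:=\hat\gamma_j(\hat\tau_{j,\sharp})$ having entries $\hat\gamma_{k,j}$, $k\neq j$, put $\tilde\tau_{j,\sharp}^2:=\hat\tau_{j,\sharp}^2+\underline\lambda\hat\tau_{j,\sharp}\|\hat\gamma_j\|_1$. $\hat\Theta_\sharp$ is the $p\times p$ matrix with $(j,j)$ entry $1/\tilde\tau_{j,\sharp}^2$ and $(k,j)$ entry $-\hat\gamma_{k,j}/\tilde\tau_{j,\sharp}^2$ for $k\ne j$ (these depend on $X$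 only, not on $\epsilon$). The de-sparsified Lasso is $$\hat b_\sharp(\sigma):=\hat\beta(\sigma)+\hat\Theta_\sharp^TX^T(Y-X\hat\beta(\sigma))/n,$$ with $j$-th entry $\hat b_{j,\sharp}(\sigma)$. *)

theory Defs
  imports "HOL-Probability.Probability"
begin

definition norm_n :: "real ^ 'n \<Rightarrow> real" where
  "norm_n v = sqrt ((v \<bullet> v) / real CARD('n))"

definition l1_norm :: "real ^ 'p \<Rightarrow> real" where
  "l1_norm b = (\<Sum>k\<in>UNIV. \<bar>b $ k\<bar>)"

definition is_lasso ::
    "real ^ 'p ^ 'n \<Rightarrow> real ^ 'n \<Rightarrow> real \<Rightarrow> real \<Rightarrow> real ^ 'p \<Rightarrow> bool" where
  "is_lasso X y lam s b \<longleftrightarrow>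
     is_arg_min (\<lambda>c. (norm_n (y - X *v c))\<^sup>2 + lam * s * l1_norm c) (\<lambda>_. True) b"

text \<open>
  A coefficient vector in \<open>\<real>\<^sup>p\<^sup>-\<^sup>1\<close>, indexed by the \<open>k \<noteq> j\<close>, is encoded as a vector \<open>g\<close>
  indexed by all of \<open>'p\<close> with \<open>g $ j = 0\<close>; this also covers \<open>p = 1\<close>.
\<close>

definition minus_col_mult :: "real ^ 'p ^ 'n \<Rightarrow> 'p \<Rightarrow> real ^ 'p \<Rightarrow> real ^ 'n" where
  "minus_col_mult X j g = (\<Sum>k\<in>UNIV - {j}. (g $ k) *\<^sub>R column k X)"

definition node_residual :: "real ^ 'p ^ 'n \<Rightarrow> 'p \<Rightarrow> real ^ 'p \<Rightarrow> real ^ 'n" where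
  "node_residual X j g = column j X - minus_col_mult X j g"

definition is_node_lasso ::
    "real ^ 'p ^ 'n \<Rightarrow> real \<Rightarrow> 'p \<Rightarrow> real \<Rightarrow> real ^ 'p \<Rightarrow> bool" where
  "is_node_lasso X lam j t g \<longleftrightarrow>
     is_arg_min (\<lambda>c. (norm_n (node_residual X j c))\<^sup>2 + 2 * lam * t * l1_norm c)
       (\<lambda>c. c $ j = 0) g"

definition tau_tilde_sq :: "real \<Rightarrow> real \<Rightarrow> real ^ 'p \<Rightarrow> real" where
  "tau_tilde_sq lam t g = t\<^sup>2 + lam * t * l1_norm g"

text \<open>Column \<open>j\<close> of \<open>node_Theta lam t g\<close> is built from the scale \<open>t j\<close> and the coefficients \<open>g j\<close>.\<close>

definition node_Theta :: "real \<Rightarrow> ('p \<Rightarrow> real) \<Rightarrow> ('p \<Rightarrow> real ^ 'p) \<Rightarrow> real ^ 'p ^ 'p" where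
  "node_Theta lam t g =
     (\<chi> k j. if k = j then 1 / tau_tilde_sq lam (t j) (g j)
            else - (g j $ k) / tau_tilde_sq lam (t j) (g j))"

definition desparsified ::
    "real ^ 'p ^ 'n \<Rightarrow> real ^ 'n \<Rightarrow> real ^ 'p ^ 'p \<Rightarrow> real ^ 'p \<Rightarrow> real ^ 'p" where
  "desparsified X y Theta b =
     b + (1 / real CARD('n)) *\<^sub>R (transpose Theta *v (transpose X *v (y - X *v b)))"

text \<open>\<open>e \<sim> N(0, s\<^sup>2 I)\<close>, where \<open>s\<close> is the standard deviation.\<close>

definition isotropic_gaussian :: "'a measure \<Rightarrow> real \<Rightarrow> ('a \<Rightarrow> real ^ 'n) \<Rightarrow> bool" where
  "isotropic_gaussian M s e \<longleftrightarrow>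
     prob_space.indep_vars M (\<lambda>_. borel) (\<lambda>i w. e w $ i) UNIV \<and>
     (\<forall>i. distributed M lborel (\<lambda>w. e w $ i) (normal_density 0 s))"

end

theory Submission imports Defs begin

text \<open>
  Writing \<open>r\<close> for the node-wise residual of column \<open>j\<close>, the matrix \<open>X\<close> maps column \<open>j\<close> of the
  surrogate inverse to \<open>r\<close> divided by the squared scale \<open>tau_tilde_sq\<close>. The optimality conditions of
  the node-wise Lasso say that \<open>r\<close> has normalised inner product exactly \<open>tau_tilde_sq\<close> with column
  \<open>j\<close>, and at most \<open>lam_low * tau_hat j\<close> in absolute value with each other column. Hence coordinate
  \<open>j\<close> of the Lasso error cancels in the de-sparsified estimator. What remains is a multiple of
  \<open>r \<bullet> eps\<close>, which is Gaussian, and a bias that the second condition controls.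
\<close>

text \<open>Divide by \<open>s\<close> and let \<open>s\<close> tend to 0 from the right. This turns
  the comparison of a minimizer with nearby points into a first-order condition without any
  subgradient calculus.\<close>

lemma le_of_scaled_quadratic_bound:
  fixes a b c :: real
  assumes "\<And>s. 0 < s \<Longrightarrow> s \<le> 1 \<Longrightarrow> s * a \<le> s\<^sup>2 * c + s * b"
  shows "a \<le> b"
proof (rule tendsto_lowerbound)
  show "((\<lambda>s. s * c + b) \<longlongrightarrow> b) (at_right 0)"
    by (auto intro!: tendsto_eq_intros)
  have "a \<le> s * c + b" if "0 < s" "s < 1" for s :: real
  proof -
    have "s * a \<le> s * (s * c + b)"
      using assms[of s] that by (simp add: power2_eq_square algebra_simps)
    then show ?thesis using that by simp
  qed
  then show "\<forall>\<^sub>F s in at_right 0. a \<le> s * c + b"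
    by (auto simp: eventually_at_right_field intro!: exI[of _ 1])
qed simp

section \<open>Norm identities and estimates\<close>

lemma norm_n_sq: "(norm_n (v :: real ^ 'n))\<^sup>2 = (v \<bullet> v) / real CARD('n)"
  by (simp add: norm_n_def)

lemma l1_norm_triangle: "l1_norm (a + b) \<le> l1_norm a + l1_norm b"
  unfolding l1_norm_def by (auto simp: sum.distrib[symmetric] intro!: sum_mono)

lemma l1_norm_scaleR: "l1_norm (c *\<^sub>R a) = \<bar>c\<bar> * l1_norm a"
  by (simp add: l1_norm_def abs_mult sum_distrib_left)

lemma l1_norm_axis: "l1_norm (axis k x) = \<bar>x\<bar>"
proof -
  have "l1_norm (axis k x) = (\<Sum>i\<in>UNIV. if i = k then \<bar>x\<bar> else 0)"
    unfolding l1_norm_def by (rule sum.cong) (auto simp: axis_def)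
  then show ?thesis by simp
qed

lemma l1_norm_nonneg: "0 \<le> l1_norm a"
  by (simp add: l1_norm_def sum_nonneg)

lemma infnorm_leI:
  fixes x :: "real ^ 'n"
  assumes "\<And>i. \<bar>x $ i\<bar> \<le> B"
  shows "infnorm x \<le> B"
  unfolding infnorm_Max using assms by (auto simp: Basis_vec_def inner_axis)

section \<open>Optimality conditions of the node-wise Lasso\<close>

lemma minus_col_mult_add_scaleR:
  "minus_col_mult X j (a + c *\<^sub>R b) = minus_col_mult X j a + c *\<^sub>R minus_col_mult X j b"
  by (simp add: minus_col_mult_def sum.distrib scaleR_sum_right scaleR_left_distrib)

lemma minus_col_mult_axis:
  assumes "k \<noteq> j"
  shows "minus_col_mult X j (axis k c) = c *\<^sub>R column k X"
proof -
  have "minus_col_mult X j (axis k c)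
      = (\<Sum>i\<in>UNIV - {j}. if i = k then c *\<^sub>R column k X else 0)"
    unfolding minus_col_mult_def by (rule sum.cong) (auto simp: axis_def)
  with assms show ?thesis by simp
qed

text \<open>Compare the objective at \<open>g\<close> and at \<open>g + s *\<^sub>R d\<close>. Here
  \<open>m\<close> bounds the slope of the penalty along \<open>d\<close> and may be negative.
  Suitable choices of \<open>d\<close> give both the bound for the other columns and the equality
  for the fit.\<close>

lemma is_node_lasso_directional:
  fixes X :: "real ^ 'p ^ 'n"
  assumes min: "is_node_lasso X lam j t g" and pos: "0 \<le> lam * t" and dj: "d $ j = 0"
    and bound: "\<And>s. 0 < s \<Longrightarrow> s \<le> 1 \<Longrightarrow> l1_norm (g + s *\<^sub>R d) \<le> l1_norm g + s * m"
  shows "(node_residual X j g \<bullet> minus_col_mult X j d) / real CARD('n) \<le> lam * t * m"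
proof -
  let ?N = "real CARD('n)" and ?r = "node_residual X j g" and ?v = "minus_col_mult X j d"
  have gj: "g $ j = 0"
    using min by (auto simp: is_node_lasso_def is_arg_min_def)
  \<comment> \<open>The left factor 2 comes from expanding the square, the right one from the
    penalty \<open>2 * lam * t\<close>.\<close>
  have "2 * ((?r \<bullet> ?v) / ?N) \<le> 2 * (lam * t * m)"
  proof (rule le_of_scaled_quadratic_bound)
    fix s :: real
    assume s: "0 < s" "s \<le> 1"
    have "(norm_n ?r)\<^sup>2 + 2 * lam * t * l1_norm g
        \<le> (norm_n (node_residual X j (g + s *\<^sub>R d)))\<^sup>2 + 2 * lam * t * l1_norm (g + s *\<^sub>R d)"
      using min dj gj by (auto simp: is_node_lasso_def is_arg_min_def not_less)
    also have "node_residual X j (g + s *\<^sub>R d) = ?r - s *\<^sub>R ?v"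
      by (simp add: node_residual_def minus_col_mult_add_scaleR)
    also have "(norm_n (?r - s *\<^sub>R ?v))\<^sup>2
        = (norm_n ?r)\<^sup>2 - s * (2 * ((?r \<bullet> ?v) / ?N)) + s\<^sup>2 * ((?v \<bullet> ?v) / ?N)"
      unfolding norm_n_sq
      by (simp add: inner_diff_left inner_diff_right inner_commute power2_eq_square field_simps)
    also have "2 * lam * t * l1_norm (g + s *\<^sub>R d) \<le> 2 * lam * t * (l1_norm g + s * m)"
      using mult_left_mono[OF bound[OF s] pos] by simp
    finally show "s * (2 * ((?r \<bullet> ?v) / ?N)) \<le> s\<^sup>2 * ((?v \<bullet> ?v) / ?N) + s * (2 * (lam * t * m))"
      by (simp add: algebra_simps)
  qed
  then show ?thesis by simp
qed

text \<open>Moving coefficient \<open>k\<close> by \<open>s\<close> in either direction raises the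
  l1 norm by at most \<open>s\<close>; the two signs together give the absolute value.\<close>

lemma is_node_lasso_other_column:
  fixes X :: "real ^ 'p ^ 'n"
  assumes "is_node_lasso X lam j t g" and "0 \<le> lam * t" and "k \<noteq> j"
  shows "\<bar>node_residual X j g \<bullet> column k X\<bar> \<le> real CARD('n) * (lam * t)"
proof -
  have "(node_residual X j g \<bullet> (c *\<^sub>R column k X)) / real CARD('n) \<le> lam * t * 1"
    if "\<bar>c\<bar> = 1" for c
  proof -
    have "l1_norm (g + s *\<^sub>R axis k c) \<le> l1_norm g + s * 1" if "0 < s" for s
      using l1_norm_triangle[of g "s *\<^sub>R axis k c"] that \<open>\<bar>c\<bar> = 1\<close>
      by (simp add: l1_norm_scaleR l1_norm_axis)
    moreover have "axis k c $ j = 0"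
      using assms(3) by (simp add: axis_def)
    ultimately show ?thesis
      using is_node_lasso_directional[OF assms(1,2), of "axis k c" 1]
      by (simp only: minus_col_mult_axis[OF assms(3)])
  qed
  from this[of 1] this[of "-1"] show ?thesis
    by (simp add: field_simps abs_le_iff)
qed

text \<open>Along the directions \<open>g\<close> and \<open>- g\<close> the penalty is exactly
  linear for small steps, so the two directional inequalities are opposite and force
  equality.\<close>

lemma is_node_lasso_inner_fit:
  fixes X :: "real ^ 'p ^ 'n"
  assumes "is_node_lasso X lam j t g" and "0 \<le> lam * t"
  shows "(node_residual X j g \<bullet> minus_col_mult X j g) / real CARD('n) = lam * t * l1_norm g"
proof -
  have gj: "g $ j = 0"
    using assms(1) by (auto simp: is_node_lasso_def is_arg_min_def)
  have "(node_residual X j g \<bullet> minus_col_mult X j (c *\<^sub>R g)) / real CARD('n)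
      \<le> lam * t * (c * l1_norm g)" if c: "\<bar>c\<bar> = 1" for c
  proof (rule is_node_lasso_directional[OF assms])
    show "(c *\<^sub>R g) $ j = 0" using gj by simp
    fix s :: real
    assume s: "0 < s" "s \<le> 1"
    have eq: "g + s *\<^sub>R c *\<^sub>R g = (1 + s * c) *\<^sub>R g"
      by (simp add: algebra_simps)
    \<comment> \<open>For \<open>c = -1\<close> this is where \<open>s \<le> 1\<close> enters: the
      rescaled vector does not pass beyond the origin.\<close>
    have "0 \<le> 1 + s * c"
      using c s by (auto simp: abs_if split: if_splits)
    then show "l1_norm (g + s *\<^sub>R c *\<^sub>R g) \<le> l1_norm g + s * (c * l1_norm g)"
      unfolding eq l1_norm_scaleR by (simp add: distrib_right)
  qed
  from this[of 1] this[of "-1"] show ?thesis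
    using minus_col_mult_add_scaleR[of X j 0 "-1" g]
    by (simp add: minus_col_mult_def)
qed

text \<open>Split column \<open>j\<close> into residual plus fit. The stable-point equation
  evaluates the first inner product and \<open>is_node_lasso_inner_fit\<close> the second; they are
  the two summands of \<open>tau_tilde_sq\<close>.\<close>

lemma is_node_lasso_own_column:
  fixes X :: "real ^ 'p ^ 'n"
  assumes "is_node_lasso X lam j t g" and "0 \<le> lam * t"
    and "t\<^sup>2 = (norm_n (node_residual X j g))\<^sup>2"
  shows "node_residual X j g \<bullet> column j X = real CARD('n) * tau_tilde_sq lam t g"
proof -
  let ?r = "node_residual X j g"
  have "column j X = ?r + minus_col_mult X j g"
    by (simp add: node_residual_def)
  then have "?r \<bullet> column j X = ?r \<bullet> ?r + ?r \<bullet> minus_col_mult X j g"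
    by (metis inner_add_right)
  then show ?thesis
    using is_node_lasso_inner_fit[OF assms(1,2)] assms(3)
    by (simp add: norm_n_sq tau_tilde_sq_def field_simps)
qed

section \<open>Coordinates of the de-sparsified estimator\<close>

lemma matrix_mult_column_node_Theta:
  fixes X :: "real ^ 'p ^ 'n"
  shows "X *v column j (node_Theta lam t g)
    = (1 / tau_tilde_sq lam (t j) (g j)) *\<^sub>R node_residual X j (g j)"
proof -
  let ?T = "tau_tilde_sq lam (t j) (g j)"
  have "X *v column j (node_Theta lam t g)
      = (\<Sum>k\<in>UNIV. (node_Theta lam t g $ k $ j) *\<^sub>R column k X)"
    by (simp add: matrix_mult_sum column_def scalar_mult_eq_scaleR)
  also have "\<dots> = (1 / ?T) *\<^sub>R column j X
      + (\<Sum>k\<in>UNIV - {j}. (node_Theta lam t g $ k $ j) *\<^sub>R column k X)"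
    by (subst sum.remove[of _ j]) (simp_all add: node_Theta_def)
  also have "(\<Sum>k\<in>UNIV - {j}. (node_Theta lam t g $ k $ j) *\<^sub>R column k X)
      = (\<Sum>k\<in>UNIV - {j}. - ((1 / ?T) *\<^sub>R (g j $ k) *\<^sub>R column k X))"
    by (rule sum.cong) (auto simp: node_Theta_def)
  also have "\<dots> = - ((1 / ?T) *\<^sub>R minus_col_mult X j (g j))"
    by (simp only: minus_col_mult_def sum_negf scaleR_sum_right)
  finally show ?thesis
    by (simp add: node_residual_def scaleR_diff_right)
qed

text \<open>Moving both transposes across the inner product leaves \<open>X\<close> applied to
  column \<open>j\<close> of the surrogate inverse, which is a scaled residual.\<close>

lemma desparsified_node_Theta_nth:
  fixes X :: "real ^ 'p ^ 'n"
  shows "desparsified X y (node_Theta lam t g) b $ j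
    = b $ j + (node_residual X j (g j) \<bullet> (y - X *v b))
        / (real CARD('n) * tau_tilde_sq lam (t j) (g j))"
proof -
  let ?u = "y - X *v b" and ?Th = "node_Theta lam t g"
  have "(transpose ?Th *v (transpose X *v ?u)) $ j = column j ?Th \<bullet> (transpose X *v ?u)"
    by (simp add: matrix_vector_mul_component transpose_def column_def)
  also have "\<dots> = (X *v column j ?Th) \<bullet> ?u"
    by (simp add: dot_lmul_matrix[symmetric] transpose_matrix_vector inner_commute)
  finally show ?thesis
    by (simp add: desparsified_def matrix_mult_column_node_Theta)
qed

lemma inner_matrix_mult_columns:
  fixes X :: "real ^ 'p ^ 'n"
  shows "r \<bullet> (X *v d) = (\<Sum>k\<in>UNIV. d $ k * (r \<bullet> column k X))"
  by (simp add: matrix_mult_sum inner_sum_right scalar_mult_eq_scaleR)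

section \<open>Linear functionals of the Gaussian noise\<close>

lemma isotropic_gaussian_inner:
  fixes e :: "'a \<Rightarrow> real ^ 'n" and v :: "real ^ 'n"
  assumes M: "prob_space M" and s: "0 < s" and e: "isotropic_gaussian M s e" and v: "v \<noteq> 0"
  shows "distributed M lborel (\<lambda>w. v \<bullet> e w) (normal_density 0 (s * norm v))"
proof -
  interpret prob_space M by (rule M)
  \<comment> \<open>A zero coefficient would give a constant summand, which has no density, so the
    sum is restricted to the support of \<open>v\<close>.\<close>
  define I where "I = {i. v $ i \<noteq> 0}"
  have I: "I \<noteq> {}" using v by (auto simp: I_def vec_eq_iff)
  have "indep_vars (\<lambda>_. borel) (\<lambda>i w. e w $ i) I"
    using e by (auto simp: isotropic_gaussian_def intro: indep_vars_subset)
  then have indep: "indep_vars (\<lambda>_. borel) (\<lambda>i w. v $ i * e w $ i) I"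
    by (rule indep_vars_compose2) simp
  have dist: "distributed M lborel (\<lambda>w. v $ i * e w $ i) (normal_density 0 (\<bar>v $ i\<bar> * s))"
    if "i \<in> I" for i
    using normal_density_affine[of "\<lambda>w. e w $ i" 0 s "v $ i" 0] e s that
    by (simp add: isotropic_gaussian_def I_def)
  have "distributed M lborel (\<lambda>w. \<Sum>i\<in>I. v $ i * e w $ i)
      (normal_density (\<Sum>i\<in>I. 0) (sqrt (\<Sum>i\<in>I. (\<bar>v $ i\<bar> * s)\<^sup>2)))"
    by (rule sum_indep_normal[OF _ I indep]) (use s dist in \<open>auto simp: I_def\<close>)
  moreover have "(\<Sum>i\<in>I. v $ i * e w $ i) = v \<bullet> e w" for w
    unfolding inner_vec_def by (rule sum.mono_neutral_cong_left) (auto simp: I_def)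
  moreover have "(\<Sum>i\<in>I. (\<bar>v $ i\<bar> * s)\<^sup>2) = (s * norm v)\<^sup>2"
  proof -
    have "(\<Sum>i\<in>I. (\<bar>v $ i\<bar> * s)\<^sup>2) = (\<Sum>i\<in>UNIV. s\<^sup>2 * (v $ i * v $ i))"
      by (rule sum.mono_neutral_cong_left) (auto simp: I_def power2_eq_square abs_mult_self_eq algebra_simps)
    then show ?thesis
      by (simp add: power_mult_distrib power2_norm_eq_inner inner_vec_def sum_distrib_left)
  qed
  ultimately show ?thesis using s by simp
qed

lemma isotropic_gaussian_inner_standardized:
  fixes e :: "'a \<Rightarrow> real ^ 'n" and v :: "real ^ 'n"
  assumes "prob_space M" and "0 < s" and "isotropic_gaussian M s e" and "v \<noteq> 0"
  shows "distributed M lborel (\<lambda>w. (v \<bullet> e w) / (s * norm v)) std_normal_density"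
proof -
  interpret prob_space M by (rule assms)
  show ?thesis
    using normal_density_affine[OF isotropic_gaussian_inner[OF assms], of "1 / (s * norm v)" 0] assms
    by simp
qed

section \<open>Decomposition into standard normal noise and bias\<close>

theorem theorem2p4p2:
  fixes M :: "'a measure"
    and X :: "real ^ 'p ^ 'n"
    and Y eps :: "'a \<Rightarrow> real ^ 'n"
    and beta0 :: "real ^ 'p"
    and sigma lam_bar lam_low :: real
    and beta_hat :: "real \<Rightarrow> 'a \<Rightarrow> real ^ 'p"
    and gamma_hat :: "'p \<Rightarrow> real \<Rightarrow> real ^ 'p"
    and tau_hat :: "'p \<Rightarrow> real"
  assumes "prob_space M"
    and "rank X = CARD('n)"
    and "sigma > 0" and "lam_bar > 0" and "lam_low > 0"
    and "isotropic_gaussian M sigma eps"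
    and "\<And>w. w \<in> space M \<Longrightarrow> Y w = X *v beta0 + eps w"
    and "\<And>s w. s > 0 \<Longrightarrow> w \<in> space M \<Longrightarrow> is_lasso X (Y w) lam_bar s (beta_hat s w)"
    and "\<And>j t. t > 0 \<Longrightarrow> is_node_lasso X lam_low j t (gamma_hat j t)"
    and "\<And>j. tau_hat j > 0"
    and "\<And>j. (tau_hat j)\<^sup>2 = (norm_n (node_residual X j (gamma_hat j (tau_hat j))))\<^sup>2"
    and "\<And>j. (norm_n (node_residual X j (gamma_hat j (tau_hat j))))\<^sup>2 \<noteq> 0"
  shows "\<exists>(Z :: 'p \<Rightarrow> 'a \<Rightarrow> real) (Delta :: 'a \<Rightarrow> real ^ 'p).
      (\<forall>j. distributed M lborel (Z j) std_normal_density) \<and>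
      (\<forall>w\<in>space M. \<forall>j.
         sqrt (real CARD('n)) * (desparsified X (Y w)
               (node_Theta lam_low tau_hat (\<lambda>i. gamma_hat i (tau_hat i)))
               (beta_hat sigma w) $ j - beta0 $ j)
           / (sigma * tau_hat j / tau_tilde_sq lam_low (tau_hat j) (gamma_hat j (tau_hat j)))
         = Z j w + Delta w $ j) \<and>
      (\<forall>w\<in>space M. infnorm (Delta w)
         \<le> sqrt (real CARD('n)) * lam_low * l1_norm (beta_hat sigma w - beta0) / sigma)"
proof -
  let ?N = "real CARD('n)"
  define r where "r j = node_residual X j (gamma_hat j (tau_hat j))" for j
  define T where "T j = tau_tilde_sq lam_low (tau_hat j) (gamma_hat j (tau_hat j))" for j
  define d where "d w = beta_hat sigma w - beta0" for w
  define Z where "Z j w = (r j \<bullet> eps w) / (sigma * norm (r j))" for j w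
  \<comment> \<open>The error \<open>d w\<close> seen through the columns other than
    \<open>j\<close>. The minus sign comes from the Lasso residual
    \<open>eps w - X *v d w\<close>.\<close>
  define Delta :: "'a \<Rightarrow> real ^ 'p" where
    "Delta w = (\<chi> j. - (\<Sum>k\<in>UNIV - {j}. d w $ k * (r j \<bullet> column k X))
        / (sqrt ?N * sigma * tau_hat j))" for w
  have lt: "0 \<le> lam_low * tau_hat j" for j
    using assms(5) assms(10)[of j] by simp
  have node: "is_node_lasso X lam_low j (tau_hat j) (gamma_hat j (tau_hat j))" for j
    by (rule assms(9)[OF assms(10)])
  have T_pos: "T j > 0" for j
    unfolding T_def tau_tilde_sq_def
    using assms(10)[of j] mult_nonneg_nonneg[OF lt[of j] l1_norm_nonneg]
    by (intro add_pos_nonneg) auto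
  \<comment> \<open>By this identity the factor that standardises \<open>Z j\<close> equals
    \<open>sqrt ?N * sigma * tau_hat j\<close>, the denominator of \<open>Delta\<close>.\<close>
  have norm_r: "norm (r j) = sqrt ?N * tau_hat j" for j
  proof -
    have "(norm (r j))\<^sup>2 = (sqrt ?N * tau_hat j)\<^sup>2"
      using assms(11)[of j]
      by (simp add: r_def norm_n_sq power_mult_distrib power2_norm_eq_inner)
    then show ?thesis
      using assms(10)[of j] by (simp add: power2_eq_iff_nonneg)
  qed
  have "distributed M lborel (Z j) std_normal_density" for j
    unfolding Z_def
  proof (rule isotropic_gaussian_inner_standardized[OF assms(1,3,6)])
    show "r j \<noteq> 0" using norm_r[of j] assms(10)[of j] by auto
  qed
  moreover have "sqrt ?N * (desparsified X (Y w)
               (node_Theta lam_low tau_hat (\<lambda>i. gamma_hat i (tau_hat i)))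
               (beta_hat sigma w) $ j - beta0 $ j) / (sigma * tau_hat j / T j)
         = Z j w + Delta w $ j" if w: "w \<in> space M" for w j
  proof -
    define S where "S = (\<Sum>k\<in>UNIV - {j}. d w $ k * (r j \<bullet> column k X))"
    have "r j \<bullet> (X *v d w) = d w $ j * (?N * T j) + S"
      unfolding inner_matrix_mult_columns S_def
      using is_node_lasso_own_column[OF node lt assms(11)]
      by (subst sum.remove[of _ j]) (simp_all add: r_def T_def)
    moreover have "Y w - X *v beta_hat sigma w = eps w - X *v d w"
      by (simp add: assms(7)[OF w] d_def matrix_vector_mult_diff_distrib)
    ultimately have "desparsified X (Y w)
          (node_Theta lam_low tau_hat (\<lambda>i. gamma_hat i (tau_hat i))) (beta_hat sigma w) $ j
        - beta0 $ j = d w $ j + (r j \<bullet> eps w - d w $ j * (?N * T j) - S) / (?N * T j)"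
      by (simp add: desparsified_node_Theta_nth d_def inner_diff_right flip: r_def T_def)
    \<comment> \<open>The own-column term divided by \<open>?N * T j\<close> is exactly
      \<open>d w $ j\<close>, so the Lasso error in coordinate \<open>j\<close> cancels.\<close>
    also have "\<dots> = (r j \<bullet> eps w - S) / (?N * T j)"
      using T_pos[of j] by (simp add: field_simps)
    \<comment> \<open>Writing \<open>?N\<close> as a product of two square roots lets one of them
      cancel against the leading factor.\<close>
    finally have "sqrt ?N * (desparsified X (Y w)
          (node_Theta lam_low tau_hat (\<lambda>i. gamma_hat i (tau_hat i))) (beta_hat sigma w) $ j
        - beta0 $ j) / (sigma * tau_hat j / T j)
        = sqrt ?N * ((r j \<bullet> eps w - S) / ((sqrt ?N * sqrt ?N) * T j)) / (sigma * tau_hat j / T j)"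
      by simp
    also have "\<dots> = (r j \<bullet> eps w - S) / (sqrt ?N * sigma * tau_hat j)"
      using T_pos[of j] by (simp add: divide_simps del: real_sqrt_mult_self)
    also have "\<dots> = Z j w + Delta w $ j"
      by (simp add: Z_def Delta_def norm_r S_def diff_divide_distrib mult_ac)
    finally show ?thesis .
  qed
  moreover have "infnorm (Delta w) \<le> sqrt ?N * lam_low * l1_norm (d w) / sigma" for w
  proof (rule infnorm_leI)
    fix j
    let ?S = "\<Sum>k\<in>UNIV - {j}. d w $ k * (r j \<bullet> column k X)"
    have "\<bar>?S\<bar> \<le> (\<Sum>k\<in>UNIV - {j}. \<bar>d w $ k\<bar> * (?N * (lam_low * tau_hat j)))"
      using is_node_lasso_other_column[OF node lt]
      by (intro order_trans[OF sum_abs] sum_mono)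
        (auto simp: abs_mult r_def intro!: mult_left_mono)
    \<comment> \<open>Adding the nonnegative term \<open>k = j\<close> completes the full l1
      norm.\<close>
    also have "\<dots> \<le> (\<Sum>k\<in>UNIV. \<bar>d w $ k\<bar> * (?N * (lam_low * tau_hat j)))"
      using lt[of j] by (intro sum_mono2) auto
    also have "\<dots> = l1_norm (d w) * ((sqrt ?N * sqrt ?N) * (lam_low * tau_hat j))"
      by (simp add: l1_norm_def sum_distrib_right)
    finally have "\<bar>?S\<bar> / (sqrt ?N * sigma * tau_hat j)
        \<le> l1_norm (d w) * ((sqrt ?N * sqrt ?N) * (lam_low * tau_hat j)) / (sqrt ?N * sigma * tau_hat j)"
      using assms(3) assms(10)[of j] by (intro divide_right_mono) auto
    \<comment> \<open>The scale \<open>tau_hat j\<close> cancels, so the bound is uniform in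
      \<open>j\<close>.\<close>
    also have "\<dots> = sqrt ?N * lam_low * l1_norm (d w) / sigma"
      using assms(3) assms(10)[of j] by (simp add: divide_simps del: real_sqrt_mult_self)
    finally show "\<bar>Delta w $ j\<bar> \<le> sqrt ?N * lam_low * l1_norm (d w) / sigma"
      using assms(3) assms(10)[of j] by (simp add: Delta_def abs_mult)
  qed
  ultimately show ?thesis
    unfolding T_def d_def by blast
qed

end
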